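(* Let $t\geq 3$ and let $\mathcal{C}_1,\mathcal{C}_2\subseteq\mathbb{Z}_2^\alpha\times\mathbb{Z}_4^\beta$ be any two additive extended perfect codes of dual type $(\alpha,\beta;\gamma,\delta)$, with $\alpha\neq 0$ and $\alpha+2\beta=2^t$. Let $\eta(\mathcal{C}_1,\mathcal{C}_2)=|\mathcal{C}_1\cap\mathcal{C}_2|$. Then: - if $\delta=1$, then $2^{\alpha+2\beta-2t}\leq\eta(\mathcal{C}_1,\mathcal{C}_2)\leq 2^{\alpha+2\beta-t-1}$; - if $\delta\neq 1$, then $2^{\alpha+2\beta-2t-1}\leq\eta(\mathcal{C}_1,\mathcal{C}_2)\leq 2^{\alpha+2\beta-t-1}$.
   Context: An additive code is a subgroup $\mathcal{C}$ of $\mathbb{Z}_2^{\alpha}\times\mathbb{Z}_4^{\beta}$. It is of type $(\alpha,\beta;\gamma,\delta)$ if $\mathcal{C}\cong\mathbb{Z}_2^{\gamma}\times\mathbb{Z}_4^{\delta}$ as a group. The inner product is $\langle u,v\rangle=2\big(\sum_{i=1}^{\alpha}u_iv_i\big)+\sum_{j=\alpha+1}^{\alpha+\beta}u_jv_j\in\mathbb{Z}_4$, and $\mathcal{C}^\perp=\{u:\langle u,v\rangle=0\text{ for all }v\in\mathcal{C}\}$. A code is of dual type $(\ldots)$ if its additive dual is of type $(\ldots)$. The Gray map $\Phi:\mathbb{Z}_2^\alpha\times\mathbb{Z}_4^\beta\to\mathbb{Z}_2^{\alpha+2\beta}$ is the identity on binary coordinates and sends each quaternary coordinate by $0\mapsto(0,0),\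 1\mapsto(0,1),\ 2\mapsto(1,1),\ 3\mapsto(1,0)$. An additive extended perfect code is an additive code $\mathcal{C}$ such that $\Phi(\mathcal{C})$ has the parameters of an extended perfect binary code: length $\alpha+2\beta=2^t$, $2^{2^t-t-1}$ codewords, minimum Hamming distance $4$. *)

theory Defs
  imports "HOL-Algebra.Product_Groups" "HOL-Algebra.Elementary_Groups"
begin

(* Coordinates are numbered from 1: the first \<alpha> are binary, the next \<beta> quaternary.
   The coordinate groups have the carriers {0..<2} and {0..<4} of int. *)
definition Z2Z4 :: "nat \<Rightarrow> nat \<Rightarrow> (nat \<Rightarrow> int) monoid" where
  "Z2Z4 \<alpha> \<beta> = product_group {1..\<alpha>+\<beta>}
     (\<lambda>i. if i \<le> \<alpha> then integer_mod_group 2 else integer_mod_group 4)"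

definition additive_code :: "nat \<Rightarrow> nat \<Rightarrow> (nat \<Rightarrow> int) set \<Rightarrow> bool" where
  "additive_code \<alpha> \<beta> C \<longleftrightarrow> subgroup C (Z2Z4 \<alpha> \<beta>)"

definition code_type :: "nat \<Rightarrow> nat \<Rightarrow> nat \<Rightarrow> nat \<Rightarrow> (nat \<Rightarrow> int) set \<Rightarrow> bool" where
  "code_type \<alpha> \<beta> \<gamma> \<delta> C \<longleftrightarrow>
     additive_code \<alpha> \<beta> C \<and> (Z2Z4 \<alpha> \<beta>)\<lparr>carrier := C\<rparr> \<cong> Z2Z4 \<gamma> \<delta>"

definition inner4 :: "nat \<Rightarrow> nat \<Rightarrow> (nat \<Rightarrow> int) \<Rightarrow> (nat \<Rightarrow> int) \<Rightarrow> int" where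
  "inner4 \<alpha> \<beta> u v =
     (2 * (\<Sum>i=1..\<alpha>. u i * v i) + (\<Sum>j=\<alpha>+1..\<alpha>+\<beta>. u j * v j)) mod 4"

definition dual_code :: "nat \<Rightarrow> nat \<Rightarrow> (nat \<Rightarrow> int) set \<Rightarrow> (nat \<Rightarrow> int) set" where
  "dual_code \<alpha> \<beta> C = {u \<in> carrier (Z2Z4 \<alpha> \<beta>). \<forall>v\<in>C. inner4 \<alpha> \<beta> u v = 0}"

definition dual_type :: "nat \<Rightarrow> nat \<Rightarrow> nat \<Rightarrow> nat \<Rightarrow> (nat \<Rightarrow> int) set \<Rightarrow> bool" where
  "dual_type \<alpha> \<beta> \<gamma> \<delta> C \<longleftrightarrow> code_type \<alpha> \<beta> \<gamma> \<delta> (dual_code \<alpha> \<beta> C)"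

(* The final branch is the value at 3; elements of Z_4 are represented by 0, 1, 2, 3. *)
definition gray4 :: "int \<Rightarrow> int list" where
  "gray4 x = (if x = 0 then [0, 0] else if x = 1 then [0, 1]
              else if x = 2 then [1, 1] else [1, 0])"

definition gray_map :: "nat \<Rightarrow> nat \<Rightarrow> (nat \<Rightarrow> int) \<Rightarrow> int list" where
  "gray_map \<alpha> \<beta> u =
     map u [1..<\<alpha>+1] @ concat (map (\<lambda>j. gray4 (u j)) [\<alpha>+1..<\<alpha>+\<beta>+1])"

definition hamming_dist :: "'a list \<Rightarrow> 'a list \<Rightarrow> nat" where
  "hamming_dist x y = card {i. i < length x \<and> x ! i \<noteq> y ! i}"

(* Meaningful for codes with at least two words; Inf {} = 0 on nat. *)
definition min_distance :: "'a list set \<Rightarrow> nat" where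
  "min_distance B = Inf {hamming_dist x y | x y. x \<in> B \<and> y \<in> B \<and> x \<noteq> y}"

definition extended_perfect_params :: "nat \<Rightarrow> int list set \<Rightarrow> bool" where
  "extended_perfect_params n B \<longleftrightarrow>
     (\<forall>x\<in>B. length x = n \<and> set x \<subseteq> {0, 1}) \<and>
     (\<exists>t. n = 2 ^ t \<and> card B = 2 ^ (2 ^ t - t - 1) \<and> min_distance B = 4)"

definition additive_extended_perfect :: "nat \<Rightarrow> nat \<Rightarrow> (nat \<Rightarrow> int) set \<Rightarrow> bool" where
  "additive_extended_perfect \<alpha> \<beta> C \<longleftrightarrow>
     additive_code \<alpha> \<beta> C \<and> extended_perfect_params (\<alpha> + 2 * \<beta>) (gray_map \<alpha> \<beta> ` C)"

definition intersection_number :: "'a set \<Rightarrow> 'a set \<Rightarrow> nat" where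
  "intersection_number C D = card (C \<inter> D)"

end

(* Let G be the ambient group, of order 2^n with n = 2^t. If the dual codes of C1 and C2 share
   at least 2^d words, then so does the dual of C1 + C2, whence |C1 + C2| <= 2^(n-d) and
   |C1 inter C2| = |C1| |C2| / |C1 + C2| >= 2^(n-2t-2+d). It remains to find common dual words.

   Let U be the n words of Gray weight 1. By the distance and the cardinality of C, the set
   X = U + C has exactly half of the elements of G, and it is disjoint from u + X for u in U
   because a sum of three elements of U has odd weight at most 3 and so is not in C. Hence adding
   u exchanges X and its complement, X is the set of odd words, and C, being disjoint from X,
   consists of even words. So (1,...,1 | 2,...,2) is in every dual: d = 1.

   If delta = 1, all non-zero doubles in the dual of C coincide. For each quaternary coordinate j
   some dual word has an odd entry at j, since otherwise biduality puts twice the j-th unit word,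
   of weight 2, into C. Thus the double is (0,...,0 | 2,...,2), which is a second independent
   common dual word: d = 2. Biduality follows from the orthogonality of the characters. *)
theory Submission
  imports Defs Complex_Main
begin

section \<open>The ambient group and its inner product\<close>

definition coord_mod :: "nat \<Rightarrow> nat \<Rightarrow> int" where
  "coord_mod \<alpha> i = (if i \<le> \<alpha> then 2 else 4)"

text \<open>The same formula serves both alphabets: on \<open>{0, 1}\<close> it is the Hamming weight.\<close>
definition lee :: "int \<Rightarrow> nat" where
  "lee x = nat (min x (4 - x))"

definition lee_weight :: "nat \<Rightarrow> (nat \<Rightarrow> int) \<Rightarrow> nat" where
  "lee_weight n u = (\<Sum>i=1..n. lee (u i))"

definition unit_word :: "nat \<Rightarrow> nat \<Rightarrow> int \<Rightarrow> nat \<Rightarrow> int" where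
  "unit_word n i a = (\<lambda>k\<in>{1..n}. if k = i then a else 0)"

lemma carrier_Z2Z4:
  "carrier (Z2Z4 \<alpha> \<beta>) = (\<Pi>\<^sub>E i\<in>{1..\<alpha>+\<beta>}. {0..<coord_mod \<alpha> i})"
  unfolding Z2Z4_def carrier_product_group
  by (rule PiE_cong) (simp add: carrier_integer_mod_group coord_mod_def)

lemma one_Z2Z4: "\<one>\<^bsub>Z2Z4 \<alpha> \<beta>\<^esub> = (\<lambda>i\<in>{1..\<alpha>+\<beta>}. 0)"
  by (auto simp: Z2Z4_def intro!: restrict_ext)

lemma mult_Z2Z4:
  "u \<otimes>\<^bsub>Z2Z4 \<alpha> \<beta>\<^esub> v = (\<lambda>i\<in>{1..\<alpha>+\<beta>}. (u i + v i) mod coord_mod \<alpha> i)"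
  by (auto simp: Z2Z4_def coord_mod_def intro!: restrict_ext)

lemma comm_group_Z2Z4: "comm_group (Z2Z4 \<alpha> \<beta>)"
proof -
  have "group (Z2Z4 \<alpha> \<beta>)" by (simp add: Z2Z4_def)
  then show ?thesis
    by (rule group.group_comm_groupI) (simp add: mult_Z2Z4 add.commute)
qed

lemma coord_mod_pos: "coord_mod \<alpha> i > 0"
  by (simp add: coord_mod_def)

lemma finite_Z2Z4: "finite (carrier (Z2Z4 \<alpha> \<beta>))"
  by (auto simp: carrier_Z2Z4 intro!: finite_PiE)

lemma card_Z2Z4: "card (carrier (Z2Z4 \<alpha> \<beta>)) = 2 ^ (\<alpha> + 2 * \<beta>)"
proof -
  have "card (carrier (Z2Z4 \<alpha> \<beta>)) = (\<Prod>i\<in>{1..\<alpha>+\<beta>}. nat (coord_mod \<alpha> i))"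
    by (simp add: carrier_Z2Z4 card_PiE)
  also have "{1..\<alpha>+\<beta>} = {1..\<alpha>} \<union> {\<alpha>+1..\<alpha>+\<beta>}" by auto
  also have "(\<Prod>i\<in>\<dots>. nat (coord_mod \<alpha> i))
    = (\<Prod>i\<in>{1..\<alpha>}. nat (coord_mod \<alpha> i)) * (\<Prod>i\<in>{\<alpha>+1..\<alpha>+\<beta>}. nat (coord_mod \<alpha> i))"
    by (rule prod.union_disjoint) auto
  also have "\<dots> = 2 ^ \<alpha> * 4 ^ \<beta>" by (simp add: coord_mod_def)
  also have "\<dots> = 2 ^ (\<alpha> + 2 * \<beta>)" by (simp add: power_add power_mult)
  finally show ?thesis .
qed

text \<open>The factor \<open>4 div coord_mod \<alpha> i\<close> is 2 on binary and 1 on quaternary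
  positions. It merges the two sums, so that all coordinates can be treated alike.\<close>

lemma inner4_eq_sum:
  "inner4 \<alpha> \<beta> u v = (\<Sum>i=1..\<alpha>+\<beta>. (4 div coord_mod \<alpha> i) * (u i * v i)) mod 4"
proof -
  have "{1..\<alpha>+\<beta>} = {1..\<alpha>} \<union> {\<alpha>+1..\<alpha>+\<beta>}" by auto
  then have "(\<Sum>i=1..\<alpha>+\<beta>. (4 div coord_mod \<alpha> i) * (u i * v i))
    = (\<Sum>i\<in>{1..\<alpha>}. (4 div coord_mod \<alpha> i) * (u i * v i))
      + (\<Sum>i\<in>{\<alpha>+1..\<alpha>+\<beta>}. (4 div coord_mod \<alpha> i) * (u i * v i))"
    by (simp only:) (rule sum.union_disjoint, auto)
  also have "\<dots> = 2 * (\<Sum>i=1..\<alpha>. u i * v i) + (\<Sum>j=\<alpha>+1..\<alpha>+\<beta>. u j * v j)"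
    by (simp add: coord_mod_def sum_distrib_left)
  finally show ?thesis by (simp add: inner4_def)
qed

section \<open>Bilinearity and non-degeneracy of the inner product\<close>

lemma inner4_commute: "inner4 \<alpha> \<beta> u v = inner4 \<alpha> \<beta> v u"
  by (simp add: inner4_def mult.commute)

lemma inner4_mult:
  "inner4 \<alpha> \<beta> (u \<otimes>\<^bsub>Z2Z4 \<alpha> \<beta>\<^esub> v) w = (inner4 \<alpha> \<beta> u w + inner4 \<alpha> \<beta> v w) mod 4"
proof -
  \<comment> \<open>Reduction modulo \<open>m\<close> changes \<open>x\<close> by a multiple of
    \<open>m\<close>, and \<open>4 div m\<close> times \<open>m\<close> is 4, so the weighted term
    keeps its value modulo 4.\<close>
  have *: "((4 div m) * (x mod m * y)) mod 4 = ((4 div m) * (x * y)) mod 4"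
    if "m = 2 \<or> m = 4" for m x y :: int
  proof -
    have "4 dvd (4 div m) * ((x - x mod m) * y)"
    proof -
      have "x - x mod m = m * (x div m)" by (simp add: minus_mod_eq_mult_div)
      then show ?thesis using that by auto
    qed
    then show ?thesis
      by (metis (no_types, lifting) left_diff_distrib right_diff_distrib mod_eq_dvd_iff)
  qed
  have "inner4 \<alpha> \<beta> (u \<otimes>\<^bsub>Z2Z4 \<alpha> \<beta>\<^esub> v) w
    = (\<Sum>i=1..\<alpha>+\<beta>. (4 div coord_mod \<alpha> i) * ((u i + v i) mod coord_mod \<alpha> i * w i)) mod 4"
    unfolding inner4_eq_sum mult_Z2Z4 by simp
  also have "\<dots> = (\<Sum>i=1..\<alpha>+\<beta>. ((4 div coord_mod \<alpha> i) * ((u i + v i) mod coord_mod \<alpha> i * w i)) mod 4) mod 4"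
    by (simp only: mod_sum_eq)
  also have "\<dots> = (\<Sum>i=1..\<alpha>+\<beta>. ((4 div coord_mod \<alpha> i) * ((u i + v i) * w i)) mod 4) mod 4"
    by (subst *) (auto simp: coord_mod_def)
  also have "\<dots> = (\<Sum>i=1..\<alpha>+\<beta>. (4 div coord_mod \<alpha> i) * ((u i + v i) * w i)) mod 4"
    by (simp only: mod_sum_eq)
  also have "(\<Sum>i=1..\<alpha>+\<beta>. (4 div coord_mod \<alpha> i) * ((u i + v i) * w i)) =
    (\<Sum>i=1..\<alpha>+\<beta>. (4 div coord_mod \<alpha> i) * (u i * w i)) + (\<Sum>i=1..\<alpha>+\<beta>. (4 div coord_mod \<alpha> i) * (v i * w i))"
    by (simp add: sum.distrib algebra_simps)
  finally show ?thesis by (simp add: inner4_eq_sum mod_add_eq)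
qed

lemma inner4_one: "inner4 \<alpha> \<beta> \<one>\<^bsub>Z2Z4 \<alpha> \<beta>\<^esub> v = 0"
  by (simp add: inner4_eq_sum one_Z2Z4)

lemma inner4_unit_word:
  assumes "i \<in> {1..\<alpha>+\<beta>}"
  shows "inner4 \<alpha> \<beta> u (unit_word (\<alpha>+\<beta>) i a) = ((4 div coord_mod \<alpha> i) * (u i * a)) mod 4"
proof -
  have "(\<Sum>k=1..\<alpha>+\<beta>. (4 div coord_mod \<alpha> k) * (u k * unit_word (\<alpha>+\<beta>) i a k))
    = (\<Sum>k=1..\<alpha>+\<beta>. if k = i then (4 div coord_mod \<alpha> i) * (u i * a) else 0)"
    by (rule sum.cong) (auto simp: unit_word_def)
  then show ?thesis using assms by (simp add: inner4_eq_sum)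
qed

lemma unit_word_carrier:
  "a \<in> {0..<coord_mod \<alpha> i} \<Longrightarrow> unit_word (\<alpha>+\<beta>) i a \<in> carrier (Z2Z4 \<alpha> \<beta>)"
  by (auto simp: carrier_Z2Z4 unit_word_def coord_mod_pos)

text \<open>Pairing with the unit word of entry 1 at \<open>i\<close> gives \<open>2 * u i\<close>
  or \<open>u i\<close> modulo 4, which vanishes within the range of \<open>u i\<close> only at
  0.\<close>

lemma inner4_nondegenerate:
  assumes u: "u \<in> carrier (Z2Z4 \<alpha> \<beta>)"
    and ort: "\<And>v. v \<in> carrier (Z2Z4 \<alpha> \<beta>) \<Longrightarrow> inner4 \<alpha> \<beta> u v = 0"
  shows "u = \<one>\<^bsub>Z2Z4 \<alpha> \<beta>\<^esub>"
proof (rule PiE_ext)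
  show "u \<in> (\<Pi>\<^sub>E i\<in>{1..\<alpha>+\<beta>}. {0..<coord_mod \<alpha> i})" using u by (simp add: carrier_Z2Z4)
  show "\<one>\<^bsub>Z2Z4 \<alpha> \<beta>\<^esub> \<in> (\<Pi>\<^sub>E i\<in>{1..\<alpha>+\<beta>}. {0..<coord_mod \<alpha> i})"
    by (simp add: one_Z2Z4 coord_mod_pos)
  fix i assume i: "i \<in> {1..\<alpha>+\<beta>}"
  have "unit_word (\<alpha>+\<beta>) i 1 \<in> carrier (Z2Z4 \<alpha> \<beta>)"
    by (rule unit_word_carrier) (simp add: coord_mod_def)
  then have "((4 div coord_mod \<alpha> i) * u i) mod 4 = 0"
    using ort i by (metis inner4_unit_word mult.right_neutral)
  moreover have "u i \<in> {0..<coord_mod \<alpha> i}" using u i by (auto simp: carrier_Z2Z4)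
  ultimately show "u i = \<one>\<^bsub>Z2Z4 \<alpha> \<beta>\<^esub> i"
    using i by (auto simp: one_Z2Z4 coord_mod_def split: if_splits)
qed

section \<open>Biduality\<close>

text \<open>The faithful character of Z_4. Composed with the inner product it yields characters of
  the ambient group.\<close>

definition chi4 :: "int \<Rightarrow> complex" where
  "chi4 a = \<i> ^ nat (a mod 4)"

lemma chi4_add: "chi4 ((a + b) mod 4) = chi4 a * chi4 b"
proof -
  have "nat ((a + b) mod 4) mod 4 = (nat (a mod 4) + nat (b mod 4)) mod 4"
  proof -
    have "int (nat ((a + b) mod 4) mod 4) = int ((nat (a mod 4) + nat (b mod 4)) mod 4)"
      by (simp add: zmod_int mod_add_eq)
    then show ?thesis by (simp only: of_nat_eq_iff)
  qed
  moreover have "\<i> ^ k = \<i> ^ (k mod 4)" for k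
  proof -
    have 1: "\<i> ^ 4 = 1" by (simp add: power4_eq_xxxx)
    have "\<i> ^ k = (\<i> ^ 4) ^ (k div 4) * \<i> ^ (k mod 4)"
      unfolding power_mult[symmetric] power_add[symmetric] by simp
    then show ?thesis unfolding 1 by simp
  qed
  ultimately show ?thesis
    unfolding chi4_def power_add[symmetric] by (metis mod_mod_trivial)
qed

lemma chi4_eq_1: "chi4 a = 1 \<longleftrightarrow> a mod 4 = 0"
proof -
  have "a mod 4 \<in> {0, 1, 2, 3}" by auto
  then show ?thesis by (auto simp: chi4_def power3_eq_cube complex_eq_iff)
qed

text \<open>If some \<open>w\<close> in \<open>K\<close> has a non-zero product with
  \<open>v\<close>, translation by \<open>w\<close> permutes \<open>K\<close> and multiplies the sum
  by a factor other than 1, so the sum is 0.\<close>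

lemma sum_chi4_subgroup:
  assumes K: "subgroup K (Z2Z4 \<alpha> \<beta>)"
  shows "(\<Sum>u\<in>K. chi4 (inner4 \<alpha> \<beta> u v)) =
    (if \<forall>u\<in>K. inner4 \<alpha> \<beta> u v = 0 then of_nat (card K) else 0)"
proof (cases "\<forall>u\<in>K. inner4 \<alpha> \<beta> u v = 0")
  case True
  then show ?thesis by (simp add: chi4_def)
next
  case False
  interpret G: comm_group "Z2Z4 \<alpha> \<beta>" by (rule comm_group_Z2Z4)
  interpret K: subgroup K "Z2Z4 \<alpha> \<beta>" by (rule K)
  from False obtain w where w: "w \<in> K" "inner4 \<alpha> \<beta> w v \<noteq> 0" by blast
  let ?S = "\<Sum>u\<in>K. chi4 (inner4 \<alpha> \<beta> u v)"
  have "bij_betw (\<lambda>u. w \<otimes>\<^bsub>Z2Z4 \<alpha> \<beta>\<^esub> u) K K"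
  proof (rule bij_betw_byWitness[where f' = "\<lambda>u. inv\<^bsub>Z2Z4 \<alpha> \<beta>\<^esub> w \<otimes>\<^bsub>Z2Z4 \<alpha> \<beta>\<^esub> u"])
  qed (use w in \<open>auto simp: G.m_assoc[symmetric]\<close>)
  then have "?S = (\<Sum>u\<in>K. chi4 (inner4 \<alpha> \<beta> (w \<otimes>\<^bsub>Z2Z4 \<alpha> \<beta>\<^esub> u) v))"
    by (rule sum.reindex_bij_betw[symmetric])
  also have "\<dots> = chi4 (inner4 \<alpha> \<beta> w v) * ?S"
    by (simp add: inner4_mult chi4_add sum_distrib_left)
  finally have "(1 - chi4 (inner4 \<alpha> \<beta> w v)) * ?S = 0" by (simp add: algebra_simps)
  moreover have "chi4 (inner4 \<alpha> \<beta> w v) \<noteq> 1"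
    using w(2) by (simp add: chi4_eq_1 inner4_def)
  ultimately show ?thesis using False by auto
qed

text \<open>Double counting of a character sum. Summing over \<open>C\<close> first leaves |C| for
  each dual word; summing over the whole group first leaves its order for the zero word of
  \<open>C\<close> alone, by non-degeneracy.\<close>

lemma card_mult_card_dual:
  assumes C: "subgroup C (Z2Z4 \<alpha> \<beta>)"
  shows "card C * card (dual_code \<alpha> \<beta> C) = card (carrier (Z2Z4 \<alpha> \<beta>))"
proof -
  let ?G = "carrier (Z2Z4 \<alpha> \<beta>)"
  interpret G: comm_group "Z2Z4 \<alpha> \<beta>" by (rule comm_group_Z2Z4)
  interpret C: subgroup C "Z2Z4 \<alpha> \<beta>" by (rule C)
  have finC: "finite C" using finite_Z2Z4 C.subset finite_subset by blast
  have "(\<Sum>v\<in>?G. \<Sum>u\<in>C. chi4 (inner4 \<alpha> \<beta> u v))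
    = (\<Sum>v\<in>?G. if v \<in> dual_code \<alpha> \<beta> C then of_nat (card C) else 0)"
    unfolding sum_chi4_subgroup[OF C]
    by (rule sum.cong) (auto simp: dual_code_def inner4_commute)
  also have "\<dots> = of_nat (card (dual_code \<alpha> \<beta> C)) * of_nat (card C)"
  proof -
    have "?G \<inter> dual_code \<alpha> \<beta> C = dual_code \<alpha> \<beta> C" by (auto simp: dual_code_def)
    then show ?thesis by (simp add: sum.If_cases finite_Z2Z4)
  qed
  finally have 1: "(\<Sum>v\<in>?G. \<Sum>u\<in>C. chi4 (inner4 \<alpha> \<beta> u v)) =
    of_nat (card C * card (dual_code \<alpha> \<beta> C))" by simp
  have "(\<Sum>u\<in>C. \<Sum>v\<in>?G. chi4 (inner4 \<alpha> \<beta> u v))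
    = (\<Sum>u\<in>C. if u = \<one>\<^bsub>Z2Z4 \<alpha> \<beta>\<^esub> then of_nat (card ?G) else 0)"
  proof (rule sum.cong)
    fix u assume u: "u \<in> C"
    have "(\<forall>v\<in>?G. inner4 \<alpha> \<beta> v u = 0) \<longleftrightarrow> u = \<one>\<^bsub>Z2Z4 \<alpha> \<beta>\<^esub>"
      using inner4_nondegenerate[of u] C.mem_carrier[OF u] by (metis inner4_commute inner4_one)
    then show "(\<Sum>v\<in>?G. chi4 (inner4 \<alpha> \<beta> u v)) = (if u = \<one>\<^bsub>Z2Z4 \<alpha> \<beta>\<^esub> then of_nat (card ?G) else 0)"
      using sum_chi4_subgroup[OF G.subgroup_self, of u] by (simp add: inner4_commute)
  qed simp
  also have "\<dots> = of_nat (card ?G)" using finC by simp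
  finally have "(of_nat (card C * card (dual_code \<alpha> \<beta> C)) :: complex) = of_nat (card ?G)"
    using 1 by (simp add: sum.swap[of _ C])
  then show ?thesis by (simp only: of_nat_eq_iff)
qed

lemma subgroup_dual_code:
  "subgroup (dual_code \<alpha> \<beta> C) (Z2Z4 \<alpha> \<beta>)"
proof -
  interpret G: comm_group "Z2Z4 \<alpha> \<beta>" by (rule comm_group_Z2Z4)
  show ?thesis
  proof (rule G.subgroupI)
    fix a assume a: "a \<in> dual_code \<alpha> \<beta> C"
    show "inv\<^bsub>Z2Z4 \<alpha> \<beta>\<^esub> a \<in> dual_code \<alpha> \<beta> C"
    proof -
      have "inner4 \<alpha> \<beta> (inv\<^bsub>Z2Z4 \<alpha> \<beta>\<^esub> a) v = 0" if "v \<in> C" for v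
        using inner4_mult[of \<alpha> \<beta> "inv\<^bsub>Z2Z4 \<alpha> \<beta>\<^esub> a" a v] a that
        by (simp add: dual_code_def G.l_inv inner4_one) (simp add: inner4_def)
      then show ?thesis using a by (simp add: dual_code_def)
    qed
  next
    show "dual_code \<alpha> \<beta> C \<noteq> {}" using inner4_one by (auto simp: dual_code_def)
  qed (auto simp: dual_code_def inner4_mult)
qed

text \<open>The cardinality formula for \<open>C\<close> and for its dual gives the double dual the
  size of \<open>C\<close>, so the evident inclusion is an equality.\<close>

lemma dual_dual_code:
  assumes C: "subgroup C (Z2Z4 \<alpha> \<beta>)"
  shows "dual_code \<alpha> \<beta> (dual_code \<alpha> \<beta> C) = C"
proof -
  let ?D = "dual_code \<alpha> \<beta>"
  have D: "subgroup (?D C) (Z2Z4 \<alpha> \<beta>)" by (rule subgroup_dual_code)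
  have "C \<subseteq> ?D (?D C)"
    using subgroup.subset[OF C] by (auto simp: dual_code_def inner4_commute)
  moreover have "card (?D (?D C)) = card C"
    using card_mult_card_dual[OF C] card_mult_card_dual[OF D]
    by (metis card_Z2Z4 mult.commute mult_cancel1 mult_zero_left power_not_zero zero_neq_numeral)
  moreover have "finite (?D (?D C))"
    by (rule finite_subset[OF _ finite_Z2Z4]) (auto simp: dual_code_def)
  ultimately show ?thesis by (metis card_subset_eq)
qed

section \<open>Lee weight and Gray map\<close>

lemma lee_weight_mult_le:
  assumes "u \<in> carrier (Z2Z4 \<alpha> \<beta>)" "v \<in> carrier (Z2Z4 \<alpha> \<beta>)"
  shows "lee_weight (\<alpha>+\<beta>) (u \<otimes>\<^bsub>Z2Z4 \<alpha> \<beta>\<^esub> v) \<le> lee_weight (\<alpha>+\<beta>) u + lee_weight (\<alpha>+\<beta>) v"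
proof -
  have "lee ((u \<otimes>\<^bsub>Z2Z4 \<alpha> \<beta>\<^esub> v) i) \<le> lee (u i) + lee (v i)" if i: "i \<in> {1..\<alpha>+\<beta>}" for i
  proof -
    have "u i \<in> {0..<coord_mod \<alpha> i}" "v i \<in> {0..<coord_mod \<alpha> i}"
      using assms i unfolding carrier_Z2Z4 by (auto dest: PiE_mem)
    then have "coord_mod \<alpha> i = 2 \<and> u i \<in> {0,1} \<and> v i \<in> {0,1}
      \<or> coord_mod \<alpha> i = 4 \<and> u i \<in> {0,1,2,3} \<and> v i \<in> {0,1,2,3}"
      by (cases "i \<le> \<alpha>"; simp add: coord_mod_def; presburger)
    then have "lee ((u i + v i) mod coord_mod \<alpha> i) \<le> lee (u i) + lee (v i)"
      by (auto simp: lee_def)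
    then show ?thesis using i by (simp add: mult_Z2Z4)
  qed
  then show ?thesis unfolding lee_weight_def sum.distrib[symmetric] by (rule sum_mono)
qed

text \<open>Both moduli are even, so reduction preserves parity. On the carrier the sum of the
  entries has the parity of the Gray weight, and unlike the weight it is easy to add.\<close>

lemma even_sum_mult:
  "even (\<Sum>i=1..\<alpha>+\<beta>. (u \<otimes>\<^bsub>Z2Z4 \<alpha> \<beta>\<^esub> v) i) \<longleftrightarrow> even ((\<Sum>i=1..\<alpha>+\<beta>. u i) + (\<Sum>i=1..\<alpha>+\<beta>. v i))"
proof -
  have "((u \<otimes>\<^bsub>Z2Z4 \<alpha> \<beta>\<^esub> v) i) mod 2 = (u i + v i) mod 2" if "i \<in> {1..\<alpha>+\<beta>}" for i
    using that by (simp add: mult_Z2Z4 coord_mod_def mod_mod_cancel)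
  then have "(\<Sum>i=1..\<alpha>+\<beta>. (u \<otimes>\<^bsub>Z2Z4 \<alpha> \<beta>\<^esub> v) i mod 2) mod 2 = (\<Sum>i=1..\<alpha>+\<beta>. (u i + v i) mod 2) mod 2"
    by (metis (no_types, lifting) sum.cong)
  then show ?thesis by (simp only: mod_sum_eq sum.distrib even_iff_mod_2_eq_zero)
qed

lemma sum_unit_word: "i \<in> {1..n} \<Longrightarrow> (\<Sum>k=1..n. unit_word n i a k) = a"
  by (simp add: unit_word_def)

lemma lee_weight_unit_word: "i \<in> {1..n} \<Longrightarrow> lee_weight n (unit_word n i a) = lee a"
proof -
  assume i: "i \<in> {1..n}"
  have "lee_weight n (unit_word n i a) = (\<Sum>k=1..n. if k = i then lee a else 0)"
    unfolding lee_weight_def by (rule sum.cong) (auto simp: unit_word_def lee_def)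
  then show ?thesis using i by simp
qed

section \<open>Hamming distance of Gray images\<close>

lemma hamming_dist_Nil: "hamming_dist [] ys = 0"
  by (simp add: hamming_dist_def)

lemma hamming_dist_Cons:
  "hamming_dist (x # xs) (y # ys) = of_bool (x \<noteq> y) + hamming_dist xs ys"
proof -
  have "{i. i < length (x # xs) \<and> (x # xs) ! i \<noteq> (y # ys) ! i}
    = (if x \<noteq> y then {0} else {}) \<union> Suc ` {i. i < length xs \<and> xs ! i \<noteq> ys ! i}"
    (is "?A = ?B")
  proof (rule Set.set_eqI)
    fix i
    show "i \<in> ?A \<longleftrightarrow> i \<in> ?B" by (cases i) auto
  qed
  then show ?thesis
    unfolding hamming_dist_def by (simp add: card_Un_disjoint card_image)
qed

lemma hamming_dist_append:
  "length xs = length ys \<Longrightarrow>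
    hamming_dist (xs @ xs') (ys @ ys') = hamming_dist xs ys + hamming_dist xs' ys'"
  by (induction xs ys rule: list_induct2) (simp_all add: hamming_dist_Cons hamming_dist_Nil)

lemma length_gray4: "length (gray4 x) = 2"
  by (simp add: gray4_def)

text \<open>The Gray images of 0, 1, 2, 3 have weights 0, 1, 2, 1, the values of \<open>lee\<close>.
  Distances from the zero word suffice for additive codes, which contain it.\<close>

lemma hamming_dist_gray_map_one:
  assumes u: "u \<in> carrier (Z2Z4 \<alpha> \<beta>)"
  shows "hamming_dist (gray_map \<alpha> \<beta> u) (gray_map \<alpha> \<beta> \<one>\<^bsub>Z2Z4 \<alpha> \<beta>\<^esub>) = lee_weight (\<alpha>+\<beta>) u"
proof -
  let ?o = "\<one>\<^bsub>Z2Z4 \<alpha> \<beta>\<^esub>"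
  have bin: "hamming_dist (map u xs) (map ?o xs) = (\<Sum>i\<leftarrow>xs. lee (u i))"
    if "set xs \<subseteq> {1..\<alpha>}" for xs
    using that
  proof (induction xs)
    case (Cons i xs)
    then have "u i \<in> {0..<coord_mod \<alpha> i}" using u unfolding carrier_Z2Z4 by (auto dest: PiE_mem)
    then have "u i \<in> {0,1}" using Cons.prems by (auto simp: coord_mod_def)
    then show ?case using Cons by (auto simp: hamming_dist_Cons one_Z2Z4 lee_def)
  qed (simp add: hamming_dist_Nil)
  have quat: "hamming_dist (concat (map (\<lambda>j. gray4 (u j)) xs)) (concat (map (\<lambda>j. gray4 (?o j)) xs))
      = (\<Sum>i\<leftarrow>xs. lee (u i))"
    if "set xs \<subseteq> {\<alpha>+1..\<alpha>+\<beta>}" for xs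
    using that
  proof (induction xs)
    case (Cons i xs)
    then have "u i \<in> {0..<coord_mod \<alpha> i}" using u unfolding carrier_Z2Z4 by (auto dest: PiE_mem)
    then have "u i \<in> {0,1,2,3}" using Cons.prems by (auto simp: coord_mod_def)
    then have "hamming_dist (gray4 (u i)) (gray4 (?o i)) = lee (u i)"
      using Cons.prems by (auto simp: hamming_dist_Cons hamming_dist_Nil one_Z2Z4 lee_def gray4_def)
    then show ?case using Cons by (simp add: hamming_dist_append length_gray4)
  qed (simp add: hamming_dist_Nil)
  have "hamming_dist (gray_map \<alpha> \<beta> u) (gray_map \<alpha> \<beta> ?o)
    = (\<Sum>i\<leftarrow>[1..<\<alpha>+1]. lee (u i)) + (\<Sum>i\<leftarrow>[\<alpha>+1..<\<alpha>+\<beta>+1]. lee (u i))"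
    unfolding gray_map_def by (subst hamming_dist_append) (simp, subst bin, force, subst quat, force, simp)
  also have "\<dots> = (\<Sum>i\<leftarrow>[1..<\<alpha>+\<beta>+1]. lee (u i))"
    using upt_add_eq_append[of 1 "\<alpha>+1" \<beta>] by simp
  also have "\<dots> = lee_weight (\<alpha>+\<beta>) u"
    unfolding lee_weight_def by (simp only: interv_sum_list_conv_sum_set_nat set_upt atLeastLessThanSuc_atLeastAtMost Suc_eq_plus1[symmetric])
  finally show ?thesis .
qed

text \<open>All \<open>gray4\<close> blocks have length 2, so equal concatenations have equal
  blocks, and \<open>gray4\<close> is injective on 0, 1, 2, 3.\<close>

lemma inj_on_gray_map: "inj_on (gray_map \<alpha> \<beta>) (carrier (Z2Z4 \<alpha> \<beta>))"
proof (rule inj_onI)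
  fix u v assume u: "u \<in> carrier (Z2Z4 \<alpha> \<beta>)" and v: "v \<in> carrier (Z2Z4 \<alpha> \<beta>)"
    and eq: "gray_map \<alpha> \<beta> u = gray_map \<alpha> \<beta> v"
  have quat: "\<forall>j\<in>set xs. u j = v j"
    if "concat (map (\<lambda>j. gray4 (u j)) xs) = concat (map (\<lambda>j. gray4 (v j)) xs)"
      and "set xs \<subseteq> {\<alpha>+1..\<alpha>+\<beta>}" for xs
    using that
  proof (induction xs)
    case (Cons i xs)
    have "u i \<in> {0..<coord_mod \<alpha> i}" "v i \<in> {0..<coord_mod \<alpha> i}"
      using u v Cons.prems unfolding carrier_Z2Z4 by (auto dest: PiE_mem)
    then have "u i \<in> {0,1,2,3}" "v i \<in> {0,1,2,3}" using Cons.prems by (auto simp: coord_mod_def)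
    moreover have "gray4 (u i) = gray4 (v i)"
      using Cons.prems by (simp add: append_eq_append_conv length_gray4)
    ultimately have "u i = v i" by (auto simp: gray4_def)
    then show ?case using Cons by simp
  qed simp
  have "map u [1..<\<alpha>+1] = map v [1..<\<alpha>+1]"
    and "concat (map (\<lambda>j. gray4 (u j)) [\<alpha>+1..<\<alpha>+\<beta>+1]) = concat (map (\<lambda>j. gray4 (v j)) [\<alpha>+1..<\<alpha>+\<beta>+1])"
    using eq unfolding gray_map_def by (simp_all add: append_eq_append_conv)
  then have "u i = v i" if "i \<in> {1..\<alpha>+\<beta>}" for i
    using that quat[of "[\<alpha>+1..<\<alpha>+\<beta>+1]"]
    by (cases "i \<le> \<alpha>") (auto simp: atLeastLessThanSuc_atLeastAtMost simp del: upt_Suc)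
  then show "u = v" using u v unfolding carrier_Z2Z4 by (metis PiE_ext)
qed

section \<open>Parity of extended perfect codes\<close>

text \<open>The words of Gray weight 1, with entry 1 or -1 at one position. At a binary position the
  two coincide, so their number is the Gray length.\<close>

definition unit_words :: "nat \<Rightarrow> nat \<Rightarrow> (nat \<Rightarrow> int) set" where
  "unit_words \<alpha> \<beta> = (\<lambda>(i, a). unit_word (\<alpha>+\<beta>) i a) ` (SIGMA i:{1..\<alpha>+\<beta>}. {1, coord_mod \<alpha> i - 1})"

lemma unit_wordsE:
  assumes "u \<in> unit_words \<alpha> \<beta>"
  obtains i a where "i \<in> {1..\<alpha>+\<beta>}" "a \<in> {1, coord_mod \<alpha> i - 1}" "u = unit_word (\<alpha>+\<beta>) i a"
  using assms that by (fastforce simp: unit_words_def)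

lemma unit_words_facts:
  assumes "u \<in> unit_words \<alpha> \<beta>"
  shows "u \<in> carrier (Z2Z4 \<alpha> \<beta>)" "lee_weight (\<alpha>+\<beta>) u = 1" "odd (\<Sum>i=1..\<alpha>+\<beta>. u i)"
    "inv\<^bsub>Z2Z4 \<alpha> \<beta>\<^esub> u \<in> unit_words \<alpha> \<beta>"
proof -
  interpret G: comm_group "Z2Z4 \<alpha> \<beta>" by (rule comm_group_Z2Z4)
  obtain i a where i: "i \<in> {1..\<alpha>+\<beta>}" and a: "a \<in> {1, coord_mod \<alpha> i - 1}"
    and u: "u = unit_word (\<alpha>+\<beta>) i a" using assms by (rule unit_wordsE)
  have carr: "a \<in> {0..<coord_mod \<alpha> i}" "coord_mod \<alpha> i - a \<in> {0..<coord_mod \<alpha> i}"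
    using a by (auto simp: coord_mod_def split: if_splits)
  show "u \<in> carrier (Z2Z4 \<alpha> \<beta>)" unfolding u by (rule unit_word_carrier) (rule carr)
  show "lee_weight (\<alpha>+\<beta>) u = 1" using a
    unfolding u lee_weight_unit_word[OF i] by (auto simp: lee_def coord_mod_def)
  show "odd (\<Sum>i=1..\<alpha>+\<beta>. u i)" using a
    unfolding u sum_unit_word[OF i] by (cases "i \<le> \<alpha>") (auto simp: coord_mod_def)
  have "unit_word (\<alpha>+\<beta>) i (coord_mod \<alpha> i - a) \<otimes>\<^bsub>Z2Z4 \<alpha> \<beta>\<^esub> unit_word (\<alpha>+\<beta>) i a = \<one>\<^bsub>Z2Z4 \<alpha> \<beta>\<^esub>"
    unfolding mult_Z2Z4 one_Z2Z4 by (rule restrict_ext) (auto simp: unit_word_def)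
  then have "inv\<^bsub>Z2Z4 \<alpha> \<beta>\<^esub> u = unit_word (\<alpha>+\<beta>) i (coord_mod \<alpha> i - a)"
    unfolding u by (rule G.inv_equality) (use carr in \<open>auto intro: unit_word_carrier\<close>)
  moreover have "coord_mod \<alpha> i - a \<in> {1, coord_mod \<alpha> i - 1}" using a by auto
  ultimately show "inv\<^bsub>Z2Z4 \<alpha> \<beta>\<^esub> u \<in> unit_words \<alpha> \<beta>" using i unfolding unit_words_def by force
qed

lemma card_unit_words: "card (unit_words \<alpha> \<beta>) = \<alpha> + 2 * \<beta>"
proof -
  have "inj_on (\<lambda>(i, a). unit_word (\<alpha>+\<beta>) i a) (SIGMA i:{1..\<alpha>+\<beta>}. {1, coord_mod \<alpha> i - 1})"
  proof (rule inj_onI, clarify)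
    fix i a j b
    assume i: "i \<in> {1..\<alpha>+\<beta>}" and j: "j \<in> {1..\<alpha>+\<beta>}"
      and a: "a \<in> {1, coord_mod \<alpha> i - 1}" and b: "b \<in> {1, coord_mod \<alpha> j - 1}"
      and eq: "unit_word (\<alpha>+\<beta>) i a = unit_word (\<alpha>+\<beta>) j b"
    have "a \<noteq> 0" using a by (auto simp: coord_mod_def split: if_splits)
    with fun_cong[OF eq, of i] i show "i = j \<and> a = b"
      by (auto simp: unit_word_def split: if_splits)
  qed
  then have "card (unit_words \<alpha> \<beta>) = (\<Sum>i=1..\<alpha>+\<beta>. card {1, coord_mod \<alpha> i - 1})"
    unfolding unit_words_def by (simp add: card_image)
  also have "{1..\<alpha>+\<beta>} = {1..\<alpha>} \<union> {\<alpha>+1..\<alpha>+\<beta>}" by auto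
  also have "(\<Sum>i\<in>\<dots>. card {1, coord_mod \<alpha> i - 1})
    = (\<Sum>i\<in>{1..\<alpha>}. card {1, coord_mod \<alpha> i - 1}) + (\<Sum>i\<in>{\<alpha>+1..\<alpha>+\<beta>}. card {1, coord_mod \<alpha> i - 1})"
    by (rule sum.union_disjoint) auto
  also have "\<dots> = \<alpha> + 2 * \<beta>" by (simp add: coord_mod_def)
  finally show ?thesis .
qed

text \<open>This feeds an induction on the sum of the entries: lowering a non-zero entry by 1 causes
  no wrap-around, so the integer sum drops by exactly 1.\<close>

lemma split_off_unit_word:
  assumes x: "x \<in> carrier (Z2Z4 \<alpha> \<beta>)" and ne: "x \<noteq> \<one>\<^bsub>Z2Z4 \<alpha> \<beta>\<^esub>"
  obtains u x' where "u \<in> unit_words \<alpha> \<beta>" "x' \<in> carrier (Z2Z4 \<alpha> \<beta>)"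
    "x = u \<otimes>\<^bsub>Z2Z4 \<alpha> \<beta>\<^esub> x'" "(\<Sum>i=1..\<alpha>+\<beta>. x i) = (\<Sum>i=1..\<alpha>+\<beta>. x' i) + 1"
proof -
  have range: "x i \<in> {0..<coord_mod \<alpha> i}" if "i \<in> {1..\<alpha>+\<beta>}" for i
    using x that unfolding carrier_Z2Z4 by (auto dest: PiE_mem)
  have xext: "x \<in> extensional {1..\<alpha>+\<beta>}" using x by (auto simp: carrier_Z2Z4 PiE_def)
  obtain i where i: "i \<in> {1..\<alpha>+\<beta>}" "x i \<noteq> 0"
  proof (rule ccontr)
    assume "\<not> thesis"
    with that have "x i = 0" if "i \<in> {1..\<alpha>+\<beta>}" for i using that by blast
    then have "x = \<one>\<^bsub>Z2Z4 \<alpha> \<beta>\<^esub>" unfolding one_Z2Z4 by (intro extensionalityI[OF xext]) auto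
    with ne show False by simp
  qed
  let ?x' = "x(i := x i - 1)"
  have "?x' \<in> carrier (Z2Z4 \<alpha> \<beta>)"
    unfolding carrier_Z2Z4
  proof (rule PiE_I)
    fix k assume "k \<in> {1..\<alpha>+\<beta>}"
    with range[OF this] i show "?x' k \<in> {0..<coord_mod \<alpha> k}" by auto
  next
    fix k assume "k \<notin> {1..\<alpha>+\<beta>}"
    then show "?x' k = undefined" using i xext by (auto simp: extensional_def)
  qed
  moreover have "unit_word (\<alpha>+\<beta>) i 1 \<in> unit_words \<alpha> \<beta>"
    using i(1) unfolding unit_words_def by force
  moreover have "x = unit_word (\<alpha>+\<beta>) i 1 \<otimes>\<^bsub>Z2Z4 \<alpha> \<beta>\<^esub> ?x'"
    unfolding mult_Z2Z4 by (rule extensionalityI[OF xext])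
      (use range in \<open>auto simp: unit_word_def mod_pos_pos_trivial\<close>)
  moreover have "(\<Sum>k=1..\<alpha>+\<beta>. x k) = (\<Sum>k=1..\<alpha>+\<beta>. ?x' k) + 1"
    using i(1) by (simp add: sum.remove[of _ i])
  ultimately show ?thesis using that by blast
qed

text \<open>Hypothesis \<open>card\<close> makes U + C half of the group once its sums are known to
  be distinct. Adding a unit word then enters or leaves U + C, just as it changes the
  parity.\<close>

lemma extended_perfect_even:
  assumes C: "subgroup C (Z2Z4 \<alpha> \<beta>)"
    and card: "2 * (\<alpha> + 2 * \<beta>) * card C = card (carrier (Z2Z4 \<alpha> \<beta>))"
    and dist: "\<And>c. c \<in> C \<Longrightarrow> c \<noteq> \<one>\<^bsub>Z2Z4 \<alpha> \<beta>\<^esub> \<Longrightarrow> 4 \<le> lee_weight (\<alpha>+\<beta>) c"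
    and c: "c \<in> C"
  shows "even (\<Sum>i=1..\<alpha>+\<beta>. c i)"
proof -
  let ?G = "carrier (Z2Z4 \<alpha> \<beta>)" and ?U = "unit_words \<alpha> \<beta>"
  interpret G: comm_group "Z2Z4 \<alpha> \<beta>" by (rule comm_group_Z2Z4)
  interpret C: subgroup C "Z2Z4 \<alpha> \<beta>" by (rule C)
  note UG = unit_words_facts(1) and U_inv = unit_words_facts(4)
  let ?f = "\<lambda>(u, c). u \<otimes>\<^bsub>Z2Z4 \<alpha> \<beta>\<^esub> c"
  \<comment> \<open>The words at Gray distance 1 from the code; they turn out to be exactly the odd words.\<close>
  define X where "X = ?f ` (?U \<times> C)"
  have XG: "X \<subseteq> ?G" by (auto simp: X_def UG)
  \<comment> \<open>Weight at most 3 is below the minimum 4, so such a sum in \<open>C\<close> would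
    be the zero word, whose entry sum is even.\<close>
  have odd3: "u \<otimes>\<^bsub>Z2Z4 \<alpha> \<beta>\<^esub> v \<otimes>\<^bsub>Z2Z4 \<alpha> \<beta>\<^esub> w \<notin> C"
    if "u \<in> ?U" "v \<in> ?U" "w \<in> ?U" for u v w
  proof
    let ?p = "u \<otimes>\<^bsub>Z2Z4 \<alpha> \<beta>\<^esub> v" and ?q = "u \<otimes>\<^bsub>Z2Z4 \<alpha> \<beta>\<^esub> v \<otimes>\<^bsub>Z2Z4 \<alpha> \<beta>\<^esub> w"
    assume "?q \<in> C"
    have "lee_weight (\<alpha>+\<beta>) ?q \<le> lee_weight (\<alpha>+\<beta>) ?p + lee_weight (\<alpha>+\<beta>) w"
      using that UG by (intro lee_weight_mult_le) auto
    also have "\<dots> \<le> lee_weight (\<alpha>+\<beta>) u + lee_weight (\<alpha>+\<beta>) v + lee_weight (\<alpha>+\<beta>) w"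
      using that UG by (intro add_mono lee_weight_mult_le) auto
    also have "\<dots> = 3" using that by (simp add: unit_words_facts(2))
    finally have "?q = \<one>\<^bsub>Z2Z4 \<alpha> \<beta>\<^esub>" using dist[OF \<open>?q \<in> C\<close>] by force
    moreover have "odd (\<Sum>i=1..\<alpha>+\<beta>. ?q i)"
      using that by (simp only: even_sum_mult even_add unit_words_facts(3)) simp
    ultimately show False by (simp add: one_Z2Z4)
  qed
  \<comment> \<open>A unit word is a sum of three: u = u + u + (-u).\<close>
  have odd1: "u \<notin> C" if u: "u \<in> ?U" for u
    using odd3[OF u u U_inv[OF u]] UG[OF u] by (simp add: G.m_assoc)
  \<comment> \<open>If u + c = u' + c', then -u' + u is a word of \<open>C\<close> of weight at most
    2, hence zero.\<close>
  have inj: "inj_on ?f (?U \<times> C)"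
  proof (rule inj_onI, clarify)
    fix u c u' c'
    assume u: "u \<in> ?U" "u' \<in> ?U" and c: "c \<in> C" "c' \<in> C"
      and eq: "u \<otimes>\<^bsub>Z2Z4 \<alpha> \<beta>\<^esub> c = u' \<otimes>\<^bsub>Z2Z4 \<alpha> \<beta>\<^esub> c'"
    let ?d = "inv\<^bsub>Z2Z4 \<alpha> \<beta>\<^esub> u' \<otimes>\<^bsub>Z2Z4 \<alpha> \<beta>\<^esub> u"
    note carr = UG[OF u(1)] UG[OF u(2)] C.mem_carrier[OF c(1)] C.mem_carrier[OF c(2)]
    have "?d \<otimes>\<^bsub>Z2Z4 \<alpha> \<beta>\<^esub> c = c'"
      using eq carr by (simp add: G.m_assoc) (simp add: G.m_assoc[symmetric])
    then have "?d = c' \<otimes>\<^bsub>Z2Z4 \<alpha> \<beta>\<^esub> inv\<^bsub>Z2Z4 \<alpha> \<beta>\<^esub> c"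
      using carr G.inv_solve_right by force
    then have "?d \<in> C" using c by simp
    moreover have "lee_weight (\<alpha>+\<beta>) ?d \<le> 1 + 1"
      using lee_weight_mult_le[OF UG[OF U_inv[OF u(2)]] UG[OF u(1)]]
        unit_words_facts(2)[OF U_inv[OF u(2)]] unit_words_facts(2)[OF u(1)] by simp
    ultimately have "?d = \<one>\<^bsub>Z2Z4 \<alpha> \<beta>\<^esub>" using dist[of ?d] by force
    then have "u = u'" using carr
      by (metis G.inv_closed G.inv_equality G.inv_inv G.m_comm)
    then show "u = u' \<and> c = c'" using eq carr by simp
  qed
  have finX: "finite X" by (rule finite_subset[OF XG finite_Z2Z4])
  have cardX: "2 * card X = card ?G"
    using card unfolding X_def card_image[OF inj] card_cartesian_product card_unit_words
    by (simp only: mult.assoc)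
  have flip: "u \<otimes>\<^bsub>Z2Z4 \<alpha> \<beta>\<^esub> x \<in> X \<longleftrightarrow> x \<notin> X" if u: "u \<in> ?U" and x: "x \<in> ?G" for u x
  proof -
    \<comment> \<open>If v + w' + c' = w + c, then -w + v + w' = c - c' lies in \<open>C\<close>,
      against \<open>odd3\<close>.\<close>
    have disj: "v \<otimes>\<^bsub>Z2Z4 \<alpha> \<beta>\<^esub> y \<notin> X" if v: "v \<in> ?U" and y: "y \<in> X" for v y
    proof
      assume "v \<otimes>\<^bsub>Z2Z4 \<alpha> \<beta>\<^esub> y \<in> X"
      then obtain w c where w: "w \<in> ?U" "c \<in> C" "v \<otimes>\<^bsub>Z2Z4 \<alpha> \<beta>\<^esub> y = w \<otimes>\<^bsub>Z2Z4 \<alpha> \<beta>\<^esub> c"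
        by (auto simp: X_def)
      obtain w' c' where w': "w' \<in> ?U" "c' \<in> C" "y = w' \<otimes>\<^bsub>Z2Z4 \<alpha> \<beta>\<^esub> c'"
        using y by (auto simp: X_def)
      note carr = UG[OF v] UG[OF w(1)] UG[OF w'(1)] C.mem_carrier[OF w(2)] C.mem_carrier[OF w'(2)]
      have "inv\<^bsub>Z2Z4 \<alpha> \<beta>\<^esub> w \<otimes>\<^bsub>Z2Z4 \<alpha> \<beta>\<^esub> v \<otimes>\<^bsub>Z2Z4 \<alpha> \<beta>\<^esub> w' \<otimes>\<^bsub>Z2Z4 \<alpha> \<beta>\<^esub> c' = c"
        using w(3) w'(3) carr by (simp add: G.m_assoc) (simp add: G.m_assoc[symmetric])
      then have "inv\<^bsub>Z2Z4 \<alpha> \<beta>\<^esub> w \<otimes>\<^bsub>Z2Z4 \<alpha> \<beta>\<^esub> v \<otimes>\<^bsub>Z2Z4 \<alpha> \<beta>\<^esub> w' = c \<otimes>\<^bsub>Z2Z4 \<alpha> \<beta>\<^esub> inv\<^bsub>Z2Z4 \<alpha> \<beta>\<^esub> c'"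
        using carr G.inv_solve_right by force
      moreover have "\<dots> \<in> C" using w w' by simp
      ultimately show False using odd3[OF U_inv[OF w(1)] v w'(1)] by simp
    qed
    \<comment> \<open>The translate of \<open>X\<close> by -u is disjoint from \<open>X\<close> and
      also has half of the elements, so it is the complement of \<open>X\<close>.\<close>
    let ?Y = "(\<lambda>y. inv\<^bsub>Z2Z4 \<alpha> \<beta>\<^esub> u \<otimes>\<^bsub>Z2Z4 \<alpha> \<beta>\<^esub> y) ` X"
    have "inj_on (\<lambda>y. inv\<^bsub>Z2Z4 \<alpha> \<beta>\<^esub> u \<otimes>\<^bsub>Z2Z4 \<alpha> \<beta>\<^esub> y) X"
      by (rule inj_on_subset[OF G.inj_on_cmult[OF G.inv_closed[OF UG[OF u]]] XG])
    then have "card ?Y = card X" by (rule card_image)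
    moreover have "X \<inter> ?Y = {}" using disj[OF U_inv[OF u]] by auto
    ultimately have "card (X \<union> ?Y) = card ?G"
      using cardX finX by (simp add: card_Un_disjoint)
    moreover have "X \<union> ?Y \<subseteq> ?G" using XG UG[OF u] by auto
    ultimately have XY: "X \<union> ?Y = ?G" using finite_Z2Z4 by (metis card_subset_eq)
    show ?thesis
    proof
      assume "u \<otimes>\<^bsub>Z2Z4 \<alpha> \<beta>\<^esub> x \<in> X"
      then show "x \<notin> X" using disj u by blast
    next
      assume "x \<notin> X"
      then obtain y where "y \<in> X" "x = inv\<^bsub>Z2Z4 \<alpha> \<beta>\<^esub> u \<otimes>\<^bsub>Z2Z4 \<alpha> \<beta>\<^esub> y" using x XY by blast
      then show "u \<otimes>\<^bsub>Z2Z4 \<alpha> \<beta>\<^esub> x \<in> X"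
        using UG[OF u] XG by (auto simp: G.m_assoc[symmetric] subset_iff)
    qed
  qed
  \<comment> \<open>With d = u + e, the unit word u = d - e would lie in \<open>C\<close>.\<close>
  have CX: "d \<notin> X" if "d \<in> C" for d
  proof
    assume "d \<in> X"
    then obtain u e where u: "u \<in> ?U" "e \<in> C" "d = u \<otimes>\<^bsub>Z2Z4 \<alpha> \<beta>\<^esub> e" by (auto simp: X_def)
    then have "u = d \<otimes>\<^bsub>Z2Z4 \<alpha> \<beta>\<^esub> inv\<^bsub>Z2Z4 \<alpha> \<beta>\<^esub> e"
      using UG[OF u(1)] C.mem_carrier by (simp add: G.m_assoc)
    then show False using odd1[OF u(1)] u(2) that by simp
  qed
  \<comment> \<open>The induction measure passes through \<open>nat\<close>; it strictly decreases
    because the smaller sum is non-negative.\<close>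
  have sum_nonneg: "0 \<le> (\<Sum>i=1..\<alpha>+\<beta>. x i)" if "x \<in> ?G" for x
    using that unfolding carrier_Z2Z4 by (intro sum_nonneg) (auto dest: PiE_mem)
  \<comment> \<open>The zero word is in \<open>C\<close>, hence outside \<open>X\<close>; splitting
    off a unit word flips both membership and parity.\<close>
  have "x \<in> X \<longleftrightarrow> odd (\<Sum>i=1..\<alpha>+\<beta>. x i)" if "x \<in> ?G" for x
    using that
  proof (induction "nat (\<Sum>i=1..\<alpha>+\<beta>. x i)" arbitrary: x rule: less_induct)
    case less
    show ?case
    proof (cases "x = \<one>\<^bsub>Z2Z4 \<alpha> \<beta>\<^esub>")
      case True
      then show ?thesis using CX[OF C.one_closed] by (simp add: one_Z2Z4)
    next
      case False
      obtain u x' where u: "u \<in> ?U" and x': "x' \<in> ?G" "x = u \<otimes>\<^bsub>Z2Z4 \<alpha> \<beta>\<^esub> x'"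
        and sum: "(\<Sum>i=1..\<alpha>+\<beta>. x i) = (\<Sum>i=1..\<alpha>+\<beta>. x' i) + 1"
        by (rule split_off_unit_word[OF less.prems False])
      have "x' \<in> X \<longleftrightarrow> odd (\<Sum>i=1..\<alpha>+\<beta>. x' i)"
        by (rule less.hyps) (use sum sum_nonneg[OF x'(1)] x' in auto)
      then show ?thesis using flip[OF u x'(1)] x'(2) sum by simp
    qed
  qed
  then show ?thesis using CX[OF c] C.mem_carrier[OF c] by blast
qed

section \<open>Intersections of codes\<close>

text \<open>One half of the product formula, by an injection: \<open>r\<close> chooses the left
  factor in a factorisation of each product.\<close>

lemma (in group) card_set_mult_ge:
  assumes H: "subgroup H G" and K: "subgroup K G" and fin: "finite H" "finite K"
  shows "card H * card K \<le> card (H \<inter> K) * card (H <#> K)"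
proof -
  interpret H: subgroup H G by (rule H)
  interpret K: subgroup K G by (rule K)
  have "\<exists>h\<in>H. \<exists>k\<in>K. x = h \<otimes> k" if "x \<in> H <#> K" for x
    using that by (auto simp: set_mult_def)
  then obtain r where r: "\<And>x. x \<in> H <#> K \<Longrightarrow> r x \<in> H \<and> (\<exists>k\<in>K. x = r x \<otimes> k)"
    by metis
  \<comment> \<open>Within a fibre of the product map, \<open>h\<close> is determined up to a factor in \<open>H \<inter> K\<close>.\<close>
  let ?f = "\<lambda>(h, k). (inv (r (h \<otimes> k)) \<otimes> h, h \<otimes> k)"
  have "card (H \<times> K) \<le> card ((H \<inter> K) \<times> (H <#> K))"
  proof (rule card_inj_on_le[of ?f])
    show "inj_on ?f (H \<times> K)"
    proof (rule inj_onI, clarify)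
      fix h k h' k'
      assume hk: "h \<in> H" "k \<in> K" "h' \<in> H" "k' \<in> K" and 1: "h \<otimes> k = h' \<otimes> k'"
        and 2: "inv (r (h \<otimes> k)) \<otimes> h = inv (r (h' \<otimes> k')) \<otimes> h'"
      have "r (h \<otimes> k) \<in> H" using r[of "h \<otimes> k"] hk by (auto simp: set_mult_def)
      then have "h = h'" using 2 hk unfolding 1 by simp
      then show "h = h' \<and> k = k'" using 1 hk by simp
    qed
    show "?f ` (H \<times> K) \<subseteq> (H \<inter> K) \<times> (H <#> K)"
    proof (rule image_subsetI)
      fix hk assume "hk \<in> H \<times> K"
      then obtain h k where hk_eq: "hk = (h, k)" and hk: "h \<in> H" "k \<in> K" by blast
      have HK: "h \<otimes> k \<in> H <#> K" using hk by (auto simp: set_mult_def)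
      with r obtain k' where k': "k' \<in> K" "h \<otimes> k = r (h \<otimes> k) \<otimes> k'" and rH: "r (h \<otimes> k) \<in> H"
        by blast
      \<comment> \<open>From hk = rk' it follows that r^-1 h = k' k^-1, so the first component lies
        in \<open>K\<close> as well as in \<open>H\<close>.\<close>
      have "inv (r (h \<otimes> k)) \<otimes> h \<otimes> k = inv (r (h \<otimes> k)) \<otimes> (r (h \<otimes> k) \<otimes> k')"
        using k'(2) hk rH by (simp add: m_assoc)
      also have "\<dots> = k'" using k'(1) rH by (simp add: m_assoc[symmetric])
      finally have "inv (r (h \<otimes> k)) \<otimes> h = k' \<otimes> inv k"
        using hk k'(1) rH inv_solve_right by force
      then have "inv (r (h \<otimes> k)) \<otimes> h \<in> K" using hk k'(1) by simp
      then show "?f hk \<in> (H \<inter> K) \<times> (H <#> K)"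
        using rH hk HK by (simp add: hk_eq)
    qed
    show "finite ((H \<inter> K) \<times> (H <#> K))"
      using fin by (simp add: set_mult_def)
  qed
  then show ?thesis by (simp add: card_cartesian_product)
qed

lemma card_Int_ge_of_common_dual:
  assumes C1: "subgroup C1 (Z2Z4 \<alpha> \<beta>)" and C2: "subgroup C2 (Z2Z4 \<alpha> \<beta>)"
    and D: "D \<subseteq> dual_code \<alpha> \<beta> C1 \<inter> dual_code \<alpha> \<beta> C2"
  shows "card D * (card C1 * card C2) \<le> card (C1 \<inter> C2) * card (carrier (Z2Z4 \<alpha> \<beta>))"
proof -
  interpret G: comm_group "Z2Z4 \<alpha> \<beta>" by (rule comm_group_Z2Z4)
  let ?S = "C1 <#>\<^bsub>Z2Z4 \<alpha> \<beta>\<^esub> C2"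
  have S: "subgroup ?S (Z2Z4 \<alpha> \<beta>)" by (rule G.mult_subgroups[OF C1 C2])
  have fin: "finite C" if "subgroup C (Z2Z4 \<alpha> \<beta>)" for C
    using finite_Z2Z4 subgroup.subset[OF that] finite_subset by blast
  have "D \<subseteq> dual_code \<alpha> \<beta> ?S"
  proof
    fix d assume "d \<in> D"
    then have d: "d \<in> carrier (Z2Z4 \<alpha> \<beta>)" "\<And>v. v \<in> C1 \<union> C2 \<Longrightarrow> inner4 \<alpha> \<beta> v d = 0"
      using D by (auto simp: dual_code_def inner4_commute)
    have "inner4 \<alpha> \<beta> v d = 0" if "v \<in> ?S" for v
      using that d(2) by (auto simp: set_mult_def inner4_mult)
    then show "d \<in> dual_code \<alpha> \<beta> ?S" using d(1) by (simp add: dual_code_def inner4_commute)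
  qed
  then have "card D \<le> card (dual_code \<alpha> \<beta> ?S)"
    by (rule card_mono[OF fin[OF subgroup_dual_code]])
  moreover have "card C1 * card C2 \<le> card (C1 \<inter> C2) * card ?S"
    by (rule G.card_set_mult_ge[OF C1 C2 fin[OF C1] fin[OF C2]])
  ultimately have "card D * (card C1 * card C2)
    \<le> card (dual_code \<alpha> \<beta> ?S) * (card (C1 \<inter> C2) * card ?S)" by (rule mult_le_mono)
  also have "\<dots> = card (C1 \<inter> C2) * card (carrier (Z2Z4 \<alpha> \<beta>))"
    unfolding card_mult_card_dual[OF S, symmetric] by (simp only: ac_simps)
  finally show ?thesis .
qed

section \<open>Common dual words\<close>

text \<open>The exponent in the definition is existential; injectivity of powers of two identifies
  it with \<open>t\<close>.\<close>

lemma additive_extended_perfectD: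
  assumes P: "additive_extended_perfect \<alpha> \<beta> C" and n: "\<alpha> + 2 * \<beta> = 2 ^ t"
  shows "subgroup C (Z2Z4 \<alpha> \<beta>)" "card C = 2 ^ (2 ^ t - t - 1)"
    "\<And>c. c \<in> C \<Longrightarrow> c \<noteq> \<one>\<^bsub>Z2Z4 \<alpha> \<beta>\<^esub> \<Longrightarrow> 4 \<le> lee_weight (\<alpha>+\<beta>) c"
proof -
  let ?g = "gray_map \<alpha> \<beta>"
  show C: "subgroup C (Z2Z4 \<alpha> \<beta>)"
    using P by (simp add: additive_extended_perfect_def additive_code_def)
  have inj: "inj_on ?g C"
    by (rule inj_on_subset[OF inj_on_gray_map subgroup.subset[OF C]])
  show "card C = 2 ^ (2 ^ t - t - 1)"
    using P n by (auto simp: additive_extended_perfect_def extended_perfect_params_def card_image[OF inj])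
  have min: "min_distance (?g ` C) = 4"
    using P by (auto simp: additive_extended_perfect_def extended_perfect_params_def)
  fix c assume c: "c \<in> C" "c \<noteq> \<one>\<^bsub>Z2Z4 \<alpha> \<beta>\<^esub>"
  let ?o = "\<one>\<^bsub>Z2Z4 \<alpha> \<beta>\<^esub>"
  have o: "?o \<in> C" by (rule subgroup.one_closed[OF C])
  have "?g c \<noteq> ?g ?o" using inj_onD[OF inj _ c(1) o] c(2) by blast
  \<comment> \<open>The infimum is at most the distance between the images of \<open>c\<close> and
    of the zero word.\<close>
  then have "min_distance (?g ` C) \<le> hamming_dist (?g c) (?g ?o)"
    unfolding min_distance_def using c(1) o by (intro cInf_lower) auto
  then show "4 \<le> lee_weight (\<alpha>+\<beta>) c"
    using hamming_dist_gray_map_one subgroup.mem_carrier[OF C c(1)] min by simp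
qed

text \<open>Chosen so that every position, binary or quaternary, contributes \<open>2 * c i\<close>
  to the inner product with \<open>c\<close>.\<close>

definition parity_word :: "nat \<Rightarrow> nat \<Rightarrow> nat \<Rightarrow> int" where
  "parity_word \<alpha> \<beta> = (\<lambda>i\<in>{1..\<alpha>+\<beta>}. if i \<le> \<alpha> then 1 else 2)"

text \<open>The only non-zero double in \<open>Z2Z4 \<gamma> 1\<close> also has this shape, with a
  single entry 2.\<close>

definition quaternary_parity_word :: "nat \<Rightarrow> nat \<Rightarrow> nat \<Rightarrow> int" where
  "quaternary_parity_word \<alpha> \<beta> = (\<lambda>i\<in>{1..\<alpha>+\<beta>}. if i \<le> \<alpha> then 0 else 2)"

text \<open>The inner product with \<open>c\<close> is twice the sum of the entries modulo 4, so
  evenness of that sum is what is needed.\<close>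

lemma parity_word_in_dual_code:
  assumes P: "additive_extended_perfect \<alpha> \<beta> C" and n: "\<alpha> + 2 * \<beta> = 2 ^ t"
  shows "parity_word \<alpha> \<beta> \<in> dual_code \<alpha> \<beta> C"
proof -
  note C = additive_extended_perfectD[OF P n]
  \<comment> \<open>This keeps the subtraction in \<open>2 ^ t - t - 1\<close> from being
    truncated.\<close>
  have "t < 2 ^ t" by (rule less_exp)
  then have "1 + t + (2 ^ t - t - 1) = (2 ^ t :: nat)" by linarith
  then have "2 * (\<alpha> + 2 * \<beta>) * card C = card (carrier (Z2Z4 \<alpha> \<beta>))"
    unfolding card_Z2Z4 n C(2) by (metis power_add power_one_right)
  then have even: "even (\<Sum>i=1..\<alpha>+\<beta>. c i)" if "c \<in> C" for c
    using extended_perfect_even[OF C(1) _ C(3) that] by blast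
  have "inner4 \<alpha> \<beta> (parity_word \<alpha> \<beta>) c = (2 * (\<Sum>i=1..\<alpha>+\<beta>. c i)) mod 4" for c
  proof -
    have "(\<Sum>i=1..\<alpha>+\<beta>. (4 div coord_mod \<alpha> i) * (parity_word \<alpha> \<beta> i * c i)) = (\<Sum>i=1..\<alpha>+\<beta>. 2 * c i)"
      by (rule sum.cong) (auto simp: parity_word_def coord_mod_def)
    then show ?thesis by (simp only: inner4_eq_sum sum_distrib_left)
  qed
  moreover have "parity_word \<alpha> \<beta> \<in> carrier (Z2Z4 \<alpha> \<beta>)"
    by (auto simp: carrier_Z2Z4 parity_word_def coord_mod_def)
  moreover have "(2 * s) mod 4 = 0" if "even s" for s :: int
    using that by (auto elim!: evenE)
  ultimately show ?thesis using even unfolding dual_code_def by simp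
qed

text \<open>Doubling kills the binary entries and sends the single quaternary entry to 0 or 2, so
  there is just one non-zero double.\<close>

lemma square_Z2Z4_one_quaternary:
  assumes "x \<in> carrier (Z2Z4 \<gamma> 1)" "x \<otimes>\<^bsub>Z2Z4 \<gamma> 1\<^esub> x \<noteq> \<one>\<^bsub>Z2Z4 \<gamma> 1\<^esub>"
  shows "x \<otimes>\<^bsub>Z2Z4 \<gamma> 1\<^esub> x = quaternary_parity_word \<gamma> 1"
proof -
  have bin: "(x i + x i) mod coord_mod \<gamma> i = 0" if "i \<le> \<gamma>" for i
    using that by (simp add: coord_mod_def)
  have quat: "(x (\<gamma>+1) + x (\<gamma>+1)) mod coord_mod \<gamma> (\<gamma>+1) \<in> {0, 2}"
    by (simp add: coord_mod_def) presburger
  have "(x (\<gamma>+1) + x (\<gamma>+1)) mod coord_mod \<gamma> (\<gamma>+1) \<noteq> 0"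
  proof
    assume 0: "(x (\<gamma>+1) + x (\<gamma>+1)) mod coord_mod \<gamma> (\<gamma>+1) = 0"
    have "(x i + x i) mod coord_mod \<gamma> i = 0" if "i \<in> {1..\<gamma>+1}" for i
      using bin[of i] 0 that by (cases "i = \<gamma>+1") auto
    then have "x \<otimes>\<^bsub>Z2Z4 \<gamma> 1\<^esub> x = \<one>\<^bsub>Z2Z4 \<gamma> 1\<^esub>"
      unfolding mult_Z2Z4 one_Z2Z4 by (rule restrict_ext)
    then show False using assms(2) by simp
  qed
  with quat have 2: "(x (\<gamma>+1) + x (\<gamma>+1)) mod coord_mod \<gamma> (\<gamma>+1) = 2" by blast
  have "(x i + x i) mod coord_mod \<gamma> i = (if i \<le> \<gamma> then 0 else 2)" if "i \<in> {1..\<gamma>+1}" for i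
    using bin[of i] 2 that by (cases "i = \<gamma>+1") auto
  then show ?thesis
    unfolding mult_Z2Z4 quaternary_parity_word_def by (rule restrict_ext)
qed

text \<open>Both claims are carried over by the isomorphism onto Z_2^\<gamma> x Z_4: that group has
  one non-zero double, and it has an element of order 4, which forces a quaternary coordinate in the
  ambient group.\<close>

lemma code_type_one_quaternary:
  assumes T: "code_type \<alpha> \<beta> \<gamma> 1 D"
  shows "\<And>v w. v \<in> D \<Longrightarrow> w \<in> D \<Longrightarrow> v \<otimes>\<^bsub>Z2Z4 \<alpha> \<beta>\<^esub> v \<noteq> \<one>\<^bsub>Z2Z4 \<alpha> \<beta>\<^esub> \<Longrightarrow>
      w \<otimes>\<^bsub>Z2Z4 \<alpha> \<beta>\<^esub> w \<noteq> \<one>\<^bsub>Z2Z4 \<alpha> \<beta>\<^esub> \<Longrightarrow> v \<otimes>\<^bsub>Z2Z4 \<alpha> \<beta>\<^esub> v = w \<otimes>\<^bsub>Z2Z4 \<alpha> \<beta>\<^esub> w"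
    and "\<beta> > 0"
proof -
  interpret G: comm_group "Z2Z4 \<alpha> \<beta>" by (rule comm_group_Z2Z4)
  interpret H: comm_group "Z2Z4 \<gamma> 1" by (rule comm_group_Z2Z4)
  have D: "subgroup D (Z2Z4 \<alpha> \<beta>)" using T by (simp add: code_type_def additive_code_def)
  interpret D: subgroup D "Z2Z4 \<alpha> \<beta>" by (rule D)
  obtain h where h: "h \<in> iso ((Z2Z4 \<alpha> \<beta>)\<lparr>carrier := D\<rparr>) (Z2Z4 \<gamma> 1)"
    using T by (auto simp: code_type_def is_iso_def)
  then have hom: "h \<in> hom ((Z2Z4 \<alpha> \<beta>)\<lparr>carrier := D\<rparr>) (Z2Z4 \<gamma> 1)"
    and bij: "bij_betw h D (carrier (Z2Z4 \<gamma> 1))" by (auto simp: iso_def)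
  have h_carr: "h v \<in> carrier (Z2Z4 \<gamma> 1)" if "v \<in> D" for v
    using bij that by (auto simp: bij_betw_def)
  have h_mult: "h (v \<otimes>\<^bsub>Z2Z4 \<alpha> \<beta>\<^esub> w) = h v \<otimes>\<^bsub>Z2Z4 \<gamma> 1\<^esub> h w" if "v \<in> D" "w \<in> D" for v w
    using hom_mult[OF hom] that by simp
  have h_one: "h \<one>\<^bsub>Z2Z4 \<alpha> \<beta>\<^esub> = \<one>\<^bsub>Z2Z4 \<gamma> 1\<^esub>"
    using hom_one[OF hom G.subgroup_imp_group[OF D] H.is_group] by simp
  have h_inj: "v = w" if "h v = h w" "v \<in> D" "w \<in> D" for v w
    using bij that by (auto simp: bij_betw_def inj_on_def)
  have square: "h (v \<otimes>\<^bsub>Z2Z4 \<alpha> \<beta>\<^esub> v) = quaternary_parity_word \<gamma> 1"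
    if v: "v \<in> D" "v \<otimes>\<^bsub>Z2Z4 \<alpha> \<beta>\<^esub> v \<noteq> \<one>\<^bsub>Z2Z4 \<alpha> \<beta>\<^esub>" for v
  proof -
    have "h v \<otimes>\<^bsub>Z2Z4 \<gamma> 1\<^esub> h v \<noteq> \<one>\<^bsub>Z2Z4 \<gamma> 1\<^esub>"
      using h_inj[of "v \<otimes>\<^bsub>Z2Z4 \<alpha> \<beta>\<^esub> v" "\<one>\<^bsub>Z2Z4 \<alpha> \<beta>\<^esub>"] v h_mult h_one by auto
    then show ?thesis
      using square_Z2Z4_one_quaternary[OF h_carr[OF v(1)]] h_mult[OF v(1) v(1)] by simp
  qed
  show "v \<otimes>\<^bsub>Z2Z4 \<alpha> \<beta>\<^esub> v = w \<otimes>\<^bsub>Z2Z4 \<alpha> \<beta>\<^esub> w"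
    if "v \<in> D" "w \<in> D" "v \<otimes>\<^bsub>Z2Z4 \<alpha> \<beta>\<^esub> v \<noteq> \<one>\<^bsub>Z2Z4 \<alpha> \<beta>\<^esub>" "w \<otimes>\<^bsub>Z2Z4 \<alpha> \<beta>\<^esub> w \<noteq> \<one>\<^bsub>Z2Z4 \<alpha> \<beta>\<^esub>" for v w
    by (rule h_inj) (use that square in auto)
  show "\<beta> > 0"
  proof (rule ccontr)
    assume "\<not> \<beta> > 0"
    then have elementary: "v \<otimes>\<^bsub>Z2Z4 \<alpha> \<beta>\<^esub> v = \<one>\<^bsub>Z2Z4 \<alpha> \<beta>\<^esub>" for v
      unfolding mult_Z2Z4 one_Z2Z4 by (intro restrict_ext) (simp add: coord_mod_def)
    \<comment> \<open>An element of order 4; if \<beta> were 0, its preimage would have a trivial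
      double.\<close>
    let ?e = "unit_word (\<gamma>+1) (\<gamma>+1) 1"
    have "?e \<in> carrier (Z2Z4 \<gamma> 1)" by (rule unit_word_carrier) (simp add: coord_mod_def)
    then obtain v where v: "v \<in> D" "h v = ?e" using bij by (metis bij_betw_def imageE)
    have "?e \<otimes>\<^bsub>Z2Z4 \<gamma> 1\<^esub> ?e = \<one>\<^bsub>Z2Z4 \<gamma> 1\<^esub>"
      using h_mult[OF v(1) v(1)] elementary[of v] h_one v(2) by simp
    from fun_cong[OF this, of "\<gamma>+1"] show False
      by (simp add: mult_Z2Z4 one_Z2Z4 unit_word_def coord_mod_def)
  qed
qed

text \<open>Dual words that are odd at different quaternary positions have the same double, so this
  one double is 2 at all of them.\<close>

lemma quaternary_parity_word_in_dual_code:
  assumes C: "subgroup C (Z2Z4 \<alpha> \<beta>)"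
    and dist: "\<And>c. c \<in> C \<Longrightarrow> c \<noteq> \<one>\<^bsub>Z2Z4 \<alpha> \<beta>\<^esub> \<Longrightarrow> 4 \<le> lee_weight (\<alpha>+\<beta>) c"
    and T: "dual_type \<alpha> \<beta> \<gamma> 1 C"
  shows "quaternary_parity_word \<alpha> \<beta> \<in> dual_code \<alpha> \<beta> C"
proof -
  let ?D = "dual_code \<alpha> \<beta> C"
  note type = code_type_one_quaternary[OF T[unfolded dual_type_def]]
  have odd: "\<exists>v\<in>?D. odd (v j)" if j: "\<alpha> < j" "j \<le> \<alpha> + \<beta>" for j
  proof (rule ccontr)
    assume "\<not> ?thesis"
    then have even: "even (v j)" if "v \<in> ?D" for v using that by blast
    \<comment> \<open>It pairs with \<open>v\<close> to \<open>2 * v j\<close>, which is 0 modulo 4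
      for even \<open>v j\<close>, while its Lee weight is only 2.\<close>
    let ?e = "unit_word (\<alpha>+\<beta>) j 2"
    have j': "j \<in> {1..\<alpha>+\<beta>}" using j by auto
    have "inner4 \<alpha> \<beta> v ?e = 0" if "v \<in> ?D" for v
      using even[OF that] j unfolding inner4_unit_word[OF j'] by (auto simp: coord_mod_def elim!: evenE)
    moreover have "?e \<in> carrier (Z2Z4 \<alpha> \<beta>)"
      using j by (intro unit_word_carrier) (simp add: coord_mod_def)
    ultimately have "?e \<in> dual_code \<alpha> \<beta> ?D"
      unfolding dual_code_def[of _ _ ?D] by (simp add: inner4_commute)
    then have "?e \<in> C" by (simp add: dual_dual_code[OF C])
    moreover have "?e j \<noteq> \<one>\<^bsub>Z2Z4 \<alpha> \<beta>\<^esub> j" using j' by (simp add: unit_word_def one_Z2Z4)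
    then have "?e \<noteq> \<one>\<^bsub>Z2Z4 \<alpha> \<beta>\<^esub>" by metis
    ultimately have "4 \<le> lee_weight (\<alpha>+\<beta>) ?e" by (rule dist)
    then show False unfolding lee_weight_unit_word[OF j'] by (simp add: lee_def)
  qed
  have square: "(v \<otimes>\<^bsub>Z2Z4 \<alpha> \<beta>\<^esub> v) j = (if odd (v j) then 2 else 0)"
    if "\<alpha> < j" "j \<le> \<alpha> + \<beta>" for v j
    using that by (simp add: mult_Z2Z4 coord_mod_def) presburger
  have nontriv: "v \<otimes>\<^bsub>Z2Z4 \<alpha> \<beta>\<^esub> v \<noteq> \<one>\<^bsub>Z2Z4 \<alpha> \<beta>\<^esub>" if "\<alpha> < j" "j \<le> \<alpha> + \<beta>" "odd (v j)" for v j
    using square[of j v] that by (auto simp: one_Z2Z4)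
  \<comment> \<open>Since \<beta> > 0, position \<alpha> + 1 is quaternary.\<close>
  obtain w where w: "w \<in> ?D" "odd (w (\<alpha>+1))" using odd[of "\<alpha>+1"] type(2) by auto
  have w2: "w \<otimes>\<^bsub>Z2Z4 \<alpha> \<beta>\<^esub> w \<noteq> \<one>\<^bsub>Z2Z4 \<alpha> \<beta>\<^esub>" using nontriv[of "\<alpha>+1" w] w(2) type(2) by simp
  have "(w i + w i) mod coord_mod \<alpha> i = (if i \<le> \<alpha> then 0 else 2)" if i: "i \<in> {1..\<alpha>+\<beta>}" for i
  proof (cases "i \<le> \<alpha>")
    case True
    then show ?thesis by (simp add: coord_mod_def)
  next
    case False
    then have i': "\<alpha> < i" "i \<le> \<alpha> + \<beta>" using i by auto
    then obtain v where v: "v \<in> ?D" "odd (v i)" using odd by blast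
    then have "w \<otimes>\<^bsub>Z2Z4 \<alpha> \<beta>\<^esub> w = v \<otimes>\<^bsub>Z2Z4 \<alpha> \<beta>\<^esub> v"
      using type(1)[OF w(1) v(1) w2] nontriv[OF i'] by blast
    then have "(w \<otimes>\<^bsub>Z2Z4 \<alpha> \<beta>\<^esub> w) i = 2" using square[OF i'] v(2) by simp
    then show ?thesis using i False by (simp add: mult_Z2Z4)
  qed
  then have "w \<otimes>\<^bsub>Z2Z4 \<alpha> \<beta>\<^esub> w = quaternary_parity_word \<alpha> \<beta>"
    unfolding mult_Z2Z4 quaternary_parity_word_def by (rule restrict_ext)
  moreover have "w \<otimes>\<^bsub>Z2Z4 \<alpha> \<beta>\<^esub> w \<in> ?D"
    using subgroup.m_closed[OF subgroup_dual_code] w(1) by blast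
  ultimately show ?thesis by simp
qed

section \<open>The lower and upper bounds\<close>

theorem theorem10:
  fixes t \<alpha> \<beta> \<gamma> \<delta> :: nat
    and C1 C2 :: "(nat \<Rightarrow> int) set"
  assumes "t \<ge> 3"
    and "\<alpha> \<noteq> 0"
    and "\<alpha> + 2 * \<beta> = 2 ^ t"
    and "additive_extended_perfect \<alpha> \<beta> C1"
    and "additive_extended_perfect \<alpha> \<beta> C2"
    and "dual_type \<alpha> \<beta> \<gamma> \<delta> C1"
    and "dual_type \<alpha> \<beta> \<gamma> \<delta> C2"
  shows "(\<delta> = 1 \<longrightarrow>
            2 ^ (\<alpha> + 2 * \<beta> - 2 * t) \<le> intersection_number C1 C2 \<and>
            intersection_number C1 C2 \<le> 2 ^ (\<alpha> + 2 * \<beta> - t - 1)) \<and>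
         (\<delta> \<noteq> 1 \<longrightarrow>
            2 ^ (\<alpha> + 2 * \<beta> - 2 * t - 1) \<le> intersection_number C1 C2 \<and>
            intersection_number C1 C2 \<le> 2 ^ (\<alpha> + 2 * \<beta> - t - 1))"
proof -
  let ?D = "dual_code \<alpha> \<beta> C1 \<inter> dual_code \<alpha> \<beta> C2"
  let ?o = "\<one>\<^bsub>Z2Z4 \<alpha> \<beta>\<^esub>" and ?p = "parity_word \<alpha> \<beta>" and ?q = "quaternary_parity_word \<alpha> \<beta>"
  note C1 = additive_extended_perfectD[OF assms(4,3)]
  note C2 = additive_extended_perfectD[OF assms(5,3)]
  have sub: "subgroup (dual_code \<alpha> \<beta> C) (Z2Z4 \<alpha> \<beta>)" for C by (rule subgroup_dual_code)
  \<comment> \<open>This keeps the exponents below free of truncated subtraction; for t = 3 it is an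
    equality.\<close>
  have t: "2 * t + 2 \<le> (2::nat) ^ t" using \<open>t \<ge> 3\<close> by (induction rule: dec_induct) auto
  have lower: "2 ^ (2 ^ t - 2 * t - 2 + d) \<le> intersection_number C1 C2"
    if D: "D \<subseteq> ?D" and cD: "card D = 2 ^ d" for D d
  proof -
    \<comment> \<open>The balance of exponents for a group of order 2^(2^t) and two codes of size
      2^(2^t - t - 1).\<close>
    have "2 ^ t + (2 ^ t - 2 * t - 2 + d) = d + (2 ^ t - t - 1) + (2 ^ t - t - 1 :: nat)"
      using t by simp
    then have "2 ^ (2 ^ t) * 2 ^ (2 ^ t - 2 * t - 2 + d) = card D * (card C1 * card C2)"
      unfolding cD C1(2) C2(2) by (metis power_add mult.assoc)
    also have "\<dots> \<le> 2 ^ (2 ^ t) * intersection_number C1 C2"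
      using card_Int_ge_of_common_dual[OF C1(1) C2(1) D]
      unfolding card_Z2Z4 intersection_number_def assms(3) by (simp only: mult.commute)
    finally show ?thesis by simp
  qed
  \<comment> \<open>An infinite set has \<open>card\<close> 0, which is no power of two.\<close>
  have "finite C1" using C1(2) by (metis card.infinite power_not_zero zero_neq_numeral)
  then have upper: "intersection_number C1 C2 \<le> 2 ^ (2 ^ t - t - 1)"
    unfolding intersection_number_def C1(2)[symmetric] by (intro card_mono) auto
  have o: "?o \<in> ?D" using subgroup.one_closed[OF sub] by blast
  have p: "?p \<in> ?D" using parity_word_in_dual_code assms by blast
  \<comment> \<open>Position 1 is binary because \<alpha> \<noteq> 0; together with position
    \<alpha> + 1 it separates the common dual words.\<close>
  have at_1: "?o 1 = 0" "?p 1 = 1" "?q 1 = 0"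
    using \<open>\<alpha> \<noteq> 0\<close> by (auto simp: one_Z2Z4 parity_word_def quaternary_parity_word_def)
  show ?thesis unfolding assms(3)
  proof (intro conjI impI upper)
    assume "\<delta> = 1"
    have q: "?q \<in> ?D"
      using quaternary_parity_word_in_dual_code[OF C1(1,3)] quaternary_parity_word_in_dual_code[OF C2(1,3)]
        assms(6,7) unfolding \<open>\<delta> = 1\<close> by blast
    have "\<beta> > 0" using code_type_one_quaternary(2) assms(6) unfolding dual_type_def \<open>\<delta> = 1\<close> by blast
    then have at_quat: "?o (\<alpha>+1) = 0" "?p (\<alpha>+1) = 2" "?q (\<alpha>+1) = 2"
      by (auto simp: one_Z2Z4 parity_word_def quaternary_parity_word_def)
    let ?r = "?p \<otimes>\<^bsub>Z2Z4 \<alpha> \<beta>\<^esub> ?q"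
    have r: "?r \<in> ?D" using subgroup.m_closed[OF sub] p q by blast
    have r_at: "?r 1 = 1" "?r (\<alpha>+1) = 0"
      using at_1 at_quat \<open>\<alpha> \<noteq> 0\<close> \<open>\<beta> > 0\<close> by (auto simp: mult_Z2Z4 coord_mod_def)
    \<comment> \<open>The entries at positions 1 and \<alpha> + 1 are (0,0), (1,2), (0,2), (1,0), so
      the four words are distinct and d = 2.\<close>
    have "?o \<noteq> ?p" "?o \<noteq> ?q" "?o \<noteq> ?r" "?p \<noteq> ?q" "?p \<noteq> ?r" "?q \<noteq> ?r"
      using at_1 at_quat r_at by (metis zero_neq_one zero_neq_numeral)+
    then have "card {?o, ?p, ?q, ?r} = 2 ^ 2" by simp
    with lower[of "{?o, ?p, ?q, ?r}" 2] o p q r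
    have "2 ^ (2 ^ t - 2 * t - 2 + 2) \<le> intersection_number C1 C2" by blast
    moreover have "2 ^ t - 2 * t - 2 + 2 = 2 ^ t - (2 * t :: nat)" using t by linarith
    ultimately show "2 ^ (2 ^ t - 2 * t) \<le> intersection_number C1 C2" by (simp only:)
  next
    have "?o \<noteq> ?p" using at_1 by (metis zero_neq_one)
    then have "card {?o, ?p} = 2 ^ 1" by simp
    with lower[of "{?o, ?p}" 1] o p
    have "2 ^ (2 ^ t - 2 * t - 2 + 1) \<le> intersection_number C1 C2" by blast
    moreover have "2 ^ t - 2 * t - 2 + 1 = 2 ^ t - 2 * t - (1::nat)" using t by simp
    ultimately show "2 ^ (2 ^ t - 2 * t - 1) \<le> intersection_number C1 C2" by (simp only:)
  qed
qed

end
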